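(* Let $T$ be a non-trivial tree with $\chi_{NL}(T)=k\ge 3$. Then $n(T)\le 2a_1(k)+a_2(k)-2=\frac12(k^3+k^2-2k-4)$, where $a_1(k)=k(k-1)$ and $a_2(k)=\frac{k(k-1)(k-2)}{2}$. Moreover, if equality holds, then $T$ has maximum degree $3$ and contains exactly $k(k-1)$ leaves, $\frac{k(k-1)(k-2)}{2}$ vertices of degree $2$, and $k(k-1)-2$ vertices of degree $3$.
   Context: All graphs are finite, simple, undirected and connected; $n(T)$ is the number of vertices. A $k$-coloring of a graph $G$ is a partition of $V(G)$ into $k$ independent sets (colors). A coloring $\{S_1,\dots,S_k\}$ is neighbor-locating (an NL-coloring) if for any two distinct vertices $u,v$ in the same color class, $\{j: N(u)\cap S_j\neq\emptyset\}\neq\{j: N(v)\cap S_j\neq\emptyset\}$. The neighbor-locating chromatic number $\chi_{NL}(G)$ is the minimum number of colors in an NL-coloring of $G$. *)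

theory Defs
  imports Complex_Main "HOL-Library.Disjoint_Sets" "Graph_Theory.Graph_Theory"
begin

text \<open>
  A finite simple undirected graph is a \<^locale>\<open>pair_graph\<close>: a finite vertex set together with a
  symmetric irreflexive relation, each undirected edge being represented by its two orientations.
\<close>

definition nbhd :: "'a pair_pre_digraph \<Rightarrow> 'a \<Rightarrow> 'a set" where
  "nbhd G v = {w. v \<rightarrow>\<^bsub>G\<^esub> w}"

definition degree :: "'a pair_pre_digraph \<Rightarrow> 'a \<Rightarrow> nat" where
  "degree G v = card (nbhd G v)"

definition max_degree :: "'a pair_pre_digraph \<Rightarrow> nat" where
  "max_degree G = Max (degree G ` pverts G)"

text \<open>
  The predicates \<^const>\<open>forest\<close> and \<^const>\<open>tree\<close> of the library are not usable here: in a symmetric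
  digraph every edge gives a directed cycle of length 2. Cycles of an undirected simple graph are
  the directed cycles of length at least 3.
\<close>

definition undirected_tree :: "'a pair_pre_digraph \<Rightarrow> bool" where
  "undirected_tree G \<longleftrightarrow>
     pair_graph G \<and> connected G \<and> \<not> (\<exists>p. pre_digraph.cycle G p \<and> 3 \<le> length p)"

definition independent :: "'a pair_pre_digraph \<Rightarrow> 'a set \<Rightarrow> bool" where
  "independent G S \<longleftrightarrow> S \<subseteq> pverts G \<and> (\<forall>u\<in>S. \<forall>v\<in>S. \<not> u \<rightarrow>\<^bsub>G\<^esub> v)"

definition coloring :: "'a pair_pre_digraph \<Rightarrow> 'a set set \<Rightarrow> bool" where
  "coloring G P \<longleftrightarrow> partition_on (pverts G) P \<and> (\<forall>S\<in>P. independent G S)"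

text \<open>
  The classes of a partition are nonempty and pairwise disjoint, hence distinct, so a class itself
  serves as its index: the set of indices j with N(u) meeting S_j is rendered as the set of classes
  that N(u) meets.
\<close>

definition nbhd_colors :: "'a pair_pre_digraph \<Rightarrow> 'a set set \<Rightarrow> 'a \<Rightarrow> 'a set set" where
  "nbhd_colors G P u = {S \<in> P. nbhd G u \<inter> S \<noteq> {}}"

definition nl_coloring :: "'a pair_pre_digraph \<Rightarrow> 'a set set \<Rightarrow> bool" where
  "nl_coloring G P \<longleftrightarrow> coloring G P \<and>
     (\<forall>S\<in>P. \<forall>u\<in>S. \<forall>v\<in>S. u \<noteq> v \<longrightarrow> nbhd_colors G P u \<noteq> nbhd_colors G P v)"

definition chi_NL :: "'a pair_pre_digraph \<Rightarrow> nat" where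
  "chi_NL G = (LEAST k. \<exists>P. nl_coloring G P \<and> card P = k)"

lemma nl_coloring_singletons:
  assumes "pair_graph G"
  shows "nl_coloring G ((\<lambda>v. {v}) ` pverts G)"
proof -
  interpret pair_graph G by fact
  show ?thesis
    by (auto simp: nl_coloring_def coloring_def independent_def partition_on_def disjoint_def
        dest: pair_no_loops)
qed

text \<open>Hence the minimum defining \<^const>\<open>chi_NL\<close> is attained:\<close>

lemma chi_NL_attained:
  assumes "pair_graph G"
  shows "\<exists>P. nl_coloring G P \<and> card P = chi_NL G"
  unfolding chi_NL_def
  by (rule LeastI_ex) (use nl_coloring_singletons[OF assms] in blast)

definition a1 :: "nat \<Rightarrow> real" where
  "a1 k = real k * (real k - 1)"

definition a2 :: "nat \<Rightarrow> real" where
  "a2 k = real k * (real k - 1) * (real k - 2) / 2"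

end

theory Submission
  imports Defs
begin

text \<open>
  In an NL-coloring with \<open>k\<close> colors, a vertex is determined by its color and its set of neighbor
  colors, which avoids its own color and has at most as many elements as the degree. This bounds the
  number of vertices of degree \<open>1\<close> by \<open>a\<^sub>1\<close> and that of degree at most \<open>2\<close> by \<open>a\<^sub>1 + a\<^sub>2\<close>. In a
  tree the degrees sum to at most \<open>2 n - 2\<close>, so the vertices of degree at least \<open>3\<close>, each counted
  with weight \<open>deg - 2\<close>, number at most the leaves minus \<open>2\<close>. Adding the two bounds gives the claim.
\<close>

section \<open>Degrees in acyclic graphs\<close>

lemma in_nbhd_iff: "w \<in> nbhd G v \<longleftrightarrow> (v, w) \<in> parcs G"
  by (simp add: nbhd_def)

lemma (in pair_wf_digraph) nbhd_subset: "nbhd G v \<subseteq> pverts G"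
  by (auto simp: in_nbhd_iff dest: in_arcsD2)

lemma (in pair_fin_digraph) finite_nbhd: "finite (nbhd G v)"
  using nbhd_subset pair_finite_verts by (rule finite_subset)

text \<open>Handshake identity without a factor 2: \<open>parcs\<close> lists both orientations of
  each edge, so every arc is counted once, at its tail.\<close>

lemma (in pair_fin_digraph) sum_degree: "(\<Sum>v\<in>pverts G. degree G v) = card (parcs G)"
proof -
  have "parcs G = Sigma (pverts G) (nbhd G)"
    by (auto simp: in_nbhd_iff dest: in_arcsD1)
  then show ?thesis
    by (simp add: degree_def card_SigmaI pair_finite_verts finite_nbhd)
qed

text \<open>The initial vertex of a longest path has all its neighbors on the path, and any neighbor
  other than the next vertex would close a cycle.\<close>

lemma (in pair_graph) acyclic_degree_le_one:
  assumes acyclic: "\<not> (\<exists>p. cycle p \<and> 3 \<le> length p)" and ne: "pverts G \<noteq> {}"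
  shows "\<exists>v\<in>pverts G. degree G v \<le> 1"
proof (rule ccontr)
  assume "\<not> ?thesis"
  then have deg: "1 < card (nbhd G v)" if "v \<in> pverts G" for v
    using that by (force simp: degree_def)
  \<comment> \<open>\<open>Q\<close> collects the lengths of simple paths. These are bounded by the
    number of vertices, which yields a longest path.\<close>
  define Q where "Q n \<longleftrightarrow> (\<exists>u p v. apath u p v \<and> length p = n)" for n
  obtain x where "x \<in> pverts G" using ne by blast
  then have "apath x [] x" by (simp add: apath_Nil_iff)
  then have "Q 0" unfolding Q_def by (metis list.size(3))
  moreover have "\<forall>n. Q n \<longrightarrow> n \<le> card (pverts G)"
    using length_apath by (auto simp: Q_def)
  ultimately obtain n where "Q n" and max: "\<And>m. Q m \<Longrightarrow> m \<le> n"
    using GreatestI_nat[of Q] Greatest_le_nat[of Q] by blast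
  then obtain u p v where p: "apath u p v" and n: "length p = n"
    by (auto simp: Q_def)
  have u: "u \<in> pverts G" using p by (auto simp: apath_def dest: awalk_hd_in_verts)
  have on_path: "w \<in> set (awalk_verts u p)" if "w \<in> nbhd G u" for w
  proof (rule ccontr)
    assume "w \<notin> set (awalk_verts u p)"
    then have "apath w ((w, u) # p) v"
      using p that arcs_symmetric by (auto simp: apath_Cons_iff in_nbhd_iff)
    then have "Q (Suc n)" unfolding Q_def using n by (metis length_Cons)
    from max[OF this] show False by simp
  qed
  have "card (nbhd G u) \<le> 1"
  proof (cases p)
    case Nil
    have "nbhd G u \<subseteq> {u}" using on_path Nil by auto
    then show ?thesis using card_mono[of "{u}" "nbhd G u"] by simp
  next
    case (Cons e es)
    define y where "y = snd e"
    have e: "e = (u, y)" and uy: "(u, y) \<in> parcs G" and es: "apath y es v"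
      and u_notin: "u \<notin> set (awalk_verts y es)"
      using p unfolding Cons y_def by (auto simp: apath_Cons_iff)
    have "nbhd G u \<subseteq> {y}"
    proof
      fix w assume w: "w \<in> nbhd G u"
      then have "w \<noteq> u" by (auto simp: in_nbhd_iff dest: no_loops')
      with on_path[OF w] have "w \<in> set (awalk_verts y es)"
        by (simp add: Cons e)
      then obtain q r where qr: "es = q @ r" "awalk y q w" "awalk w r v"
        using awalk_decomp[of y es v w] es by (auto simp: apath_def)
      have q: "apath y q w"
        using es qr by (auto simp: apath_append_iff)
      show "w \<in> {y}"
      proof (rule ccontr)
        assume "w \<notin> {y}"
        \<comment> \<open>The closed walk goes from \<open>w\<close> to \<open>u\<close>, on to
          \<open>y\<close>, and back to \<open>w\<close> along \<open>q\<close>. Nonemptiness of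
          \<open>q\<close> is what makes its length at least 3, ruling out a mere back-and-forth
          along one edge.\<close>
        then have "q \<noteq> []" using qr by (auto simp: awalk_Nil_iff)
        moreover have "u \<notin> set (awalk_verts y q)"
          using u_notin es qr by (auto simp: apath_def awalk_verts_append)
        moreover have "awalk w ((w, u) # (u, y) # q) w"
          using w uy qr arcs_symmetric by (auto simp: awalk_Cons_iff in_nbhd_iff)
        ultimately have "cycle ((w, u) # (u, y) # q) \<and> 3 \<le> length ((w, u) # (u, y) # q)"
          using q by (cases q) (auto simp: cycle_def apath_def)
        with acyclic show False by blast
      qed
    qed
    then show ?thesis using card_mono[of "{y}" "nbhd G u"] by simp
  qed
  with deg[OF u] show False by simp
qed

definition remove_vert :: "'a pair_pre_digraph \<Rightarrow> 'a \<Rightarrow> 'a pair_pre_digraph" where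
  "remove_vert G v = \<lparr>pverts = pverts G - {v}, parcs = {e \<in> parcs G. fst e \<noteq> v \<and> snd e \<noteq> v}\<rparr>"

lemma pair_graph_remove_vert:
  assumes "pair_graph G"
  shows "pair_graph (remove_vert G v)"
proof -
  interpret pair_graph G by fact
  show ?thesis
    by unfold_locales
      (auto simp: remove_vert_def symmetric_def sym_def pair_finite_verts pair_finite_arcs
        intro: arcs_symmetric dest: in_arcsD1 in_arcsD2 no_loops')
qed

text \<open>The graph enters the notion of a cycle only through membership in its vertex and arc
  sets, and deletion shrinks both.\<close>

lemma cycle_remove_vertD:
  "pre_digraph.cycle (remove_vert G v) p \<Longrightarrow> pre_digraph.cycle G p"
  by (auto simp: pre_digraph.cycle_def pre_digraph.awalk_def remove_vert_def
      cas_with_proj_eq awalk_verts_with_proj_eq)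

text \<open>The bound of n - 1 edges, doubled because arcs are counted. Acyclicity survives vertex
  deletion, so induction applies after removing a vertex of degree at most 1, which costs at most
  two arcs.\<close>

lemma card_parcs_acyclic:
  assumes "pair_graph G" and "\<not> (\<exists>p. pre_digraph.cycle G p \<and> 3 \<le> length p)"
    and "pverts G \<noteq> {}"
  shows "card (parcs G) + 2 \<le> 2 * card (pverts G)"
  using assms
proof (induction "card (pverts G)" arbitrary: G rule: less_induct)
  case less
  interpret pair_graph G by fact
  obtain v where v: "v \<in> pverts G" "degree G v \<le> 1"
    using acyclic_degree_le_one[OF less.prems(2,3)] by (elim bexE)
  let ?H = "remove_vert G v"
  have card_H: "Suc (card (pverts ?H)) = card (pverts G)"
    using v pair_finite_verts by (simp add: remove_vert_def card_Suc_Diff1 del: card_Diff_insert)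
  show ?case
  proof (cases "pverts ?H = {}")
    case True
    then have "x = v" if "x \<in> pverts G" for x using that by (auto simp: remove_vert_def)
    then have "parcs G = {}" by (auto dest: in_arcsD1 in_arcsD2 no_loops')
    then show ?thesis using card_H by simp
  next
    case False
    have IH: "card (parcs ?H) + 2 \<le> 2 * card (pverts ?H)"
      using less.hyps[of ?H] pair_graph_remove_vert[OF less.prems(1)] card_H False
        less.prems(2) cycle_remove_vertD by (metis lessI)
    have "parcs G \<subseteq> parcs ?H \<union> (Pair v ` nbhd G v \<union> (\<lambda>w. (w, v)) ` nbhd G v)"
      by (auto simp: remove_vert_def in_nbhd_iff image_iff intro: arcs_symmetric)
    moreover have "finite (parcs ?H)" by (simp add: remove_vert_def pair_finite_arcs)
    ultimately have "card (parcs G)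
        \<le> card (parcs ?H \<union> (Pair v ` nbhd G v \<union> (\<lambda>w. (w, v)) ` nbhd G v))"
      by (intro card_mono) (auto simp: finite_nbhd)
    also have "\<dots> \<le> card (parcs ?H) + (card (nbhd G v) + card (nbhd G v))"
      by (intro order.trans[OF card_Un_le] add_mono card_image_le finite_nbhd order.refl)
    also have "\<dots> \<le> card (parcs ?H) + 2"
      using v by (simp add: degree_def)
    finally show ?thesis using IH card_H by simp
  qed
qed

text \<open>The first arc of a walk from \<open>v\<close> to some other vertex supplies a
  neighbor.\<close>

lemma (in pair_graph) connected_degree_pos:
  assumes "connected G" and "2 \<le> card (pverts G)" and v: "v \<in> pverts G"
  shows "0 < degree G v"
proof -
  have "\<exists>w\<in>pverts G. w \<noteq> v"
  proof (rule ccontr)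
    assume "\<not> ?thesis"
    then have "pverts G \<subseteq> {v}" by blast
    then show False using assms(2) card_mono[of "{v}" "pverts G"] by simp
  qed
  then obtain w where w: "w \<in> pverts G" "w \<noteq> v" by blast
  have "v \<rightarrow>\<^sup>*\<^bsub>G\<^esub> w"
    using symmetric_connected_imp_strongly_connected[OF pair_sym_arcs assms(1)] v w by auto
  then obtain p where p: "awalk v p w" by (auto simp: reachable_awalk)
  with w have "p \<noteq> []" by (auto simp: awalk_Nil_iff)
  with p have "nbhd G v \<noteq> {}" by (cases p) (auto simp: awalk_Cons_iff in_nbhd_iff)
  then show ?thesis by (simp add: degree_def card_gt_0_iff finite_nbhd)
qed

section \<open>Vertices of small degree in an NL-coloring\<close>

text \<open>Choosing one neighbor in each color met is injective, since color classes are
  disjoint.\<close>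

lemma card_nbhd_colors_le_degree:
  assumes "pair_graph G" and "coloring G P"
  shows "card (nbhd_colors G P v) \<le> degree G v"
proof -
  interpret pair_graph G by fact
  have disj: "disjoint P"
    using assms(2) by (auto simp: coloring_def partition_on_def)
  have "\<forall>S\<in>nbhd_colors G P v. \<exists>w. w \<in> nbhd G v \<inter> S"
    by (auto simp: nbhd_colors_def)
  then obtain g where g: "\<And>S. S \<in> nbhd_colors G P v \<Longrightarrow> g S \<in> nbhd G v \<inter> S"
    by metis
  have "inj_on g (nbhd_colors G P v)"
  proof (rule inj_onI)
    fix S R assume *: "S \<in> nbhd_colors G P v" "R \<in> nbhd_colors G P v" "g S = g R"
    then have "g S \<in> S \<inter> R" using g by (metis IntD2 IntI)
    with * disj show "S = R" by (auto simp: nbhd_colors_def disjoint_def)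
  qed
  with g show ?thesis
    unfolding degree_def by (intro card_inj_on_le[of g]) (auto simp: finite_nbhd)
qed

text \<open>Inside a class \<open>S\<close> the map \<open>nbhd_colors G P\<close> is injective by
  the NL property. On degrees \<open>1..d\<close> its values are nonempty subsets of
  \<open>P - {S}\<close> with at most \<open>d\<close> elements; these are counted by size and the
  bound is summed over the classes.\<close>

lemma card_degree_le_nl_coloring:
  assumes "pair_graph G" and nl: "nl_coloring G P"
  shows "card {v \<in> pverts G. degree G v \<in> {1..d}} \<le> card P * (\<Sum>j=1..d. (card P - 1) choose j)"
proof -
  interpret pair_graph G by fact
  have col: "coloring G P" using nl by (simp add: nl_coloring_def)
  then have union: "\<Union>P = pverts G" and indep: "\<And>S. S \<in> P \<Longrightarrow> independent G S"
    by (auto simp: coloring_def partition_on_def)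
  have fin: "finite P"
    using union pair_finite_verts by (metis finite_UnionD)
  let ?D = "{v \<in> pverts G. degree G v \<in> {1..d}}"
  have bound: "card (S \<inter> ?D) \<le> (\<Sum>j=1..d. (card P - 1) choose j)" if S: "S \<in> P" for S
  proof -
    let ?A = "\<lambda>j. {C. C \<subseteq> P - {S} \<and> card C = j}"
    have "inj_on (nbhd_colors G P) (S \<inter> ?D)"
      using nl S by (auto simp: nl_coloring_def inj_on_def)
    moreover have "nbhd_colors G P ` (S \<inter> ?D) \<subseteq> (\<Union>j\<in>{1..d}. ?A j)"
    proof clarify
      fix v assume v: "v \<in> S" "v \<in> pverts G" "degree G v \<in> {1..d}"
      have sub: "nbhd_colors G P v \<subseteq> P - {S}"
        using indep[OF S] v by (auto simp: nbhd_colors_def independent_def nbhd_def)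
      have "nbhd G v \<noteq> {}" using v by (auto simp: degree_def)
      then obtain w where "w \<in> nbhd G v" by blast
      moreover from this have "w \<in> \<Union>P" using nbhd_subset union by blast
      ultimately have "nbhd_colors G P v \<noteq> {}" by (auto simp: nbhd_colors_def)
      then have "0 < card (nbhd_colors G P v)"
        using sub fin by (metis card_gt_0_iff finite_Diff finite_subset)
      moreover have "card (nbhd_colors G P v) \<le> d"
        using card_nbhd_colors_le_degree[OF assms(1) col, of v] v by simp
      ultimately show "nbhd_colors G P v \<in> (\<Union>j\<in>{1..d}. ?A j)" using sub by auto
    qed
    moreover have fin_A: "finite (?A j)" for j
      by (rule finite_subset[of _ "Pow (P - {S})"]) (use fin in auto)
    ultimately have "card (S \<inter> ?D) \<le> card (\<Union>j\<in>{1..d}. ?A j)"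
      by (intro card_inj_on_le) auto
    also have "\<dots> \<le> (\<Sum>j=1..d. card (?A j))"
      by (intro card_UN_le) simp
    also have "\<dots> = (\<Sum>j=1..d. (card P - 1) choose j)"
      using fin S by (simp add: n_subsets)
    finally show ?thesis .
  qed
  have "?D = (\<Union>S\<in>P. S \<inter> ?D)" using union by blast
  then have "card ?D \<le> (\<Sum>S\<in>P. card (S \<inter> ?D))"
    using card_UN_le[OF fin, of "\<lambda>S. S \<inter> ?D"] by simp
  also have "\<dots> \<le> (\<Sum>S\<in>P. \<Sum>j=1..d. (card P - 1) choose j)"
    by (intro sum_mono bound)
  finally show ?thesis by simp
qed

section \<open>Counting by degree\<close>

lemma real_choose_two: "real (n choose 2) = real n * (real n - 1) / 2"
  by (cases n) (simp_all add: choose_two real_of_nat_div algebra_simps)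

theorem theorem25:
  fixes T :: "'a pair_pre_digraph" and k :: nat
  assumes "undirected_tree T"
    and "card (pverts T) \<ge> 2"
    and "chi_NL T = k"
    and "k \<ge> 3"
  shows "real (card (pverts T)) \<le> 2 * a1 k + a2 k - 2
    \<and> 2 * a1 k + a2 k - 2 = (real k ^ 3 + real k ^ 2 - 2 * real k - 4) / 2
    \<and> (real (card (pverts T)) = 2 * a1 k + a2 k - 2 \<longrightarrow>
        max_degree T = 3
        \<and> real (card {v \<in> pverts T. degree T v = 1}) = real k * (real k - 1)
        \<and> real (card {v \<in> pverts T. degree T v = 2}) = real k * (real k - 1) * (real k - 2) / 2
        \<and> real (card {v \<in> pverts T. degree T v = 3}) = real k * (real k - 1) - 2)"
proof -
  interpret pair_graph T using assms(1) by (simp add: undirected_tree_def)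
  have T: "pair_graph T" by (rule pair_graph)
  obtain P where P: "nl_coloring T P" "card P = k"
    using chi_NL_attained[OF T] assms(3) by blast
  let ?V = "pverts T"
  define D where "D i = {v \<in> ?V. degree T v = i}" for i
  \<comment> \<open>All degrees from 4 on are pooled: the bound needs only that each such vertex has
    degree at least 4, and equality will force \<open>H\<close> to be empty.\<close>
  define H where "H = {v \<in> ?V. 4 \<le> degree T v}"
  have fin: "finite ?V" by (rule pair_finite_verts)
  have ne: "?V \<noteq> {}" using assms(2) by auto
  have finD: "finite (D i)" "finite H" for i using fin by (auto simp: D_def H_def)
  have pos: "0 < degree T v" if "v \<in> ?V" for v
    using connected_degree_pos[OF _ assms(2) that] assms(1) by (simp add: undirected_tree_def)
  have V: "?V = D 1 \<union> (D 2 \<union> (D 3 \<union> H))"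
    using pos by (force simp: D_def H_def)
  have disj: "D 1 \<inter> (D 2 \<union> (D 3 \<union> H)) = {}" "D 2 \<inter> (D 3 \<union> H) = {}" "D 3 \<inter> H = {}"
    by (auto simp: D_def H_def)
  have sum_V: "sum f ?V = sum f (D 1) + (sum f (D 2) + (sum f (D 3) + sum f H))"
    for f :: "'a \<Rightarrow> nat"
    unfolding V using disj finD by (simp add: sum.union_disjoint)
  have sum_D: "sum (degree T) (D i) = i * card (D i)" for i
    by (simp add: D_def)
  have n: "card ?V = card (D 1) + card (D 2) + card (D 3) + card H"
    using sum_V[of "\<lambda>_. 1"] by simp
  have "card H * 4 \<le> sum (degree T) H"
    using sum_bounded_below[of H 4 "degree T"] by (simp add: H_def)
  moreover have "sum (degree T) ?V + 2 \<le> 2 * card ?V"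
    using card_parcs_acyclic[OF T] assms(1) ne by (simp add: sum_degree undirected_tree_def)
  \<comment> \<open>Subtracting 2 per vertex from the degree sum leaves -1 for each leaf, 0 for
    degree 2, 1 for degree 3 and at least 2 on \<open>H\<close>.\<close>
  ultimately have tree: "card (D 3) + 2 * card H + 2 \<le> card (D 1)"
    unfolding sum_V sum_D n by simp
  have k1: "real (k - Suc 0) = real k - 1" using assms(4) by (simp add: of_nat_diff)
  have "D 1 = {v \<in> ?V. degree T v \<in> {1..1}}" by (auto simp: D_def)
  then have "card (D 1) \<le> k * (k - 1)"
    using card_degree_le_nl_coloring[OF T P(1), of 1] P(2) by simp
  then have "real (card (D 1)) \<le> real (k * (k - 1))" by (simp only: of_nat_le_iff)
  then have leaves: "real (card (D 1)) \<le> a1 k"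
    by (simp add: a1_def k1)
  have "D 1 \<union> D 2 = {v \<in> ?V. degree T v \<in> {1..2}}" by (auto simp: D_def)
  moreover have "card (D 1 \<union> D 2) = card (D 1) + card (D 2)"
    using disj finD by (intro card_Un_disjoint) auto
  \<comment> \<open>For \<open>d = 2\<close> the binomial sum has two terms; multiplied by
    \<open>k\<close> they are \<open>a1 k\<close> and \<open>a2 k\<close>.\<close>
  ultimately have "card (D 1) + card (D 2) \<le> k * ((k - 1) + ((k - 1) choose 2))"
    using card_degree_le_nl_coloring[OF T P(1), of 2] P(2) by (simp add: numeral_2_eq_2)
  then have "real (card (D 1) + card (D 2)) \<le> real (k * ((k - 1) + ((k - 1) choose 2)))"
    by (simp only: of_nat_le_iff)
  then have small: "real (card (D 1)) + real (card (D 2)) \<le> a1 k + a2 k"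
    by (simp add: a1_def a2_def k1 real_choose_two field_simps)
  have tree': "real (card (D 3)) + 2 * real (card H) + 2 \<le> real (card (D 1))"
    using tree by linarith
  have n': "real (card ?V) = real (card (D 1)) + real (card (D 2)) + real (card (D 3)) + real (card H)"
    using n by simp
  have le: "real (card ?V) \<le> 2 * a1 k + a2 k - 2"
    using leaves small tree' n' by linarith
  have eq: "2 * a1 k + a2 k - 2 = (real k ^ 3 + real k ^ 2 - 2 * real k - 4) / 2"
    by (simp add: a1_def a2_def field_simps power2_eq_square power3_eq_cube)
  have "max_degree T = 3 \<and> real (card (D 1)) = a1 k \<and> real (card (D 2)) = a2 k
      \<and> real (card (D 3)) = a1 k - 2"
    if max: "real (card ?V) = 2 * a1 k + a2 k - 2"
  proof -
    \<comment> \<open>The bounds chain to n \<le> \<open>2 * a1 k + a2 k - 2 - card H\<close>.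
      Equality therefore empties \<open>H\<close> and makes \<open>leaves\<close>,
      \<open>small\<close> and \<open>tree'\<close> tight, which fixes all three counts.\<close>
    have H: "real (card H) = 0" and D: "real (card (D 1)) = a1 k" "real (card (D 2)) = a2 k"
      "real (card (D 3)) = a1 k - 2"
      using max leaves small tree' n' by linarith+
    \<comment> \<open>From \<open>k \<ge> 3\<close> follows \<open>a1 k - 2 > 0\<close>, so degree 3
      is attained.\<close>
    have "3 * 2 \<le> real k * (real k - 1)"
      using assms(4) by (intro mult_mono) auto
    then have "card (D 3) \<noteq> 0" using D(3) by (auto simp: a1_def)
    then obtain v where "v \<in> ?V" "degree T v = 3"
      using finD by (auto simp: D_def)
    moreover have "degree T w \<le> 3" if "w \<in> ?V" for w
      using H finD(2) that by (auto simp: H_def)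
    ultimately have "max_degree T = 3"
      unfolding max_degree_def using fin by (intro Max_eqI) force+
    with D show ?thesis by blast
  qed
  with le eq show ?thesis by (auto simp: D_def a1_def a2_def)
qed

end
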